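(* Let the non-negative function $\sigma\in L^1(\mathbb{R}^{2d})$ be supported in a compact set $\Omega\subseteq\mathbb{R}^{2d}$ with $0\le\sigma(z)\le C_\sigma<\infty$ for $z\in\Omega$. Consider the localization operator $H_\sigma f=\mathcal{V}_\varphi^*(\sigma\mathcal{V}_\varphi f)$ with $\varphi\in M^1(\mathbb{R}^d)$, $\|\varphi\|_2=1$, and with spectral representation $H_\sigma f=\sum_{j=1}^\infty c_j\langle f,\varphi_j\rangle\varphi_j$, where $(c_j)\in\ell^1$ is the positive sequence of eigenvalues and $(\varphi_j)$ is an orthonormal system of eigenfunctions. Then the eigenfunctions $\varphi_j$ of $H_\sigma$ satisfy the time-frequency concentration $$\int_\Omega|\mathcal{V}_\varphi\varphi_j(z)|^2\,dz\ge\frac{c_j}{C_\sigma}.$$ Equality holds if and only if $\sigma(z)/C_\sigma=\chi_\Omega(z)$ is the characteristic function of $\Omega$.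
   Context: For $z=(x,\omega)\in\mathbb{R}^{2d}$, $\pi(z)f(t)=e^{2\pi i\omega\cdot t}f(t-x)$. $\mathcal{V}_\varphi f(z)=\langle f,\pi(z)\varphi\rangle$ is the short-time Fourier transform and $\mathcal{V}_\varphi^*F=\int_{\mathbb{R}^{2d}}F(z)\pi(z)\varphi\,dz$, so that $\langle H_\sigma f,h\rangle=\int_{\mathbb{R}^{2d}}\sigma\,\mathcal{V}_\varphi f\,\overline{\mathcal{V}_\varphi h}\,dz$ for $f,h\in L^2(\mathbb{R}^d)$. $M^1(\mathbb{R}^d)$ is the space of $f\in L^2(\mathbb{R}^d)$ with $\int_{\mathbb{R}^{2d}}|\mathcal{V}_gf(z)|\,dz<\infty$, where $g(t)=e^{-\pi t\cdot t}$. $\chi_\Omega$ is the function equal to $1$ on $\Omega$ and $0$ elsewhere. Under the hypotheses $H_\sigma$ is a positive trace-class operator on $L^2(\mathbb{R}^d)$.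
   Formalization: "Only if" is false as stated (compactly supported φ, Ω with an extra far piece). It is proved when equality holds for all j and Ω lies, up to a null set, in the essential support of σ, or when it holds for one j with V_φ φ_j nonzero a.e. on Ω. The inequality and "if" are unconditional. *)

theory Defs
  imports "HOL-Analysis.Analysis"
begin

text \<open>
  Elements of \<open>L\<^sup>2\<close> are represented by Borel functions that are only identified almost
  everywhere, so equations between them are stated with \<open>AE\<close> or in the \<open>L\<^sup>2\<close> norm.
  A point of phase space is a pair \<open>(x, \<omega>)\<close>.
\<close>

definition L2 :: "((real^'n) \<Rightarrow> complex) set" where
  "L2 = {f \<in> borel_measurable lborel. integrable lborel (\<lambda>t. (cmod (f t))\<^sup>2)}"

definition L2_inner :: "((real^'n) \<Rightarrow> complex) \<Rightarrow> ((real^'n) \<Rightarrow> complex) \<Rightarrow> complex" where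
  "L2_inner f g = (LINT t|lborel. f t * cnj (g t))"

definition L2_norm :: "((real^'n) \<Rightarrow> complex) \<Rightarrow> real" where
  "L2_norm f = sqrt (LINT t|lborel. (cmod (f t))\<^sup>2)"

definition L2_sums :: "(nat \<Rightarrow> (real^'n) \<Rightarrow> complex) \<Rightarrow> ((real^'n) \<Rightarrow> complex) \<Rightarrow> bool" where
  "L2_sums g u \<longleftrightarrow> u \<in> L2 \<and> (\<forall>j. g j \<in> L2) \<and>
     (\<lambda>N. L2_norm (\<lambda>t. u t - (\<Sum>j<N. g j t))) \<longlonglongrightarrow> 0"

definition orthonormal_system :: "(nat \<Rightarrow> (real^'n) \<Rightarrow> complex) \<Rightarrow> bool" where
  "orthonormal_system e \<longleftrightarrow> (\<forall>j. e j \<in> L2) \<and>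
     (\<forall>i j. L2_inner (e i) (e j) = (if i = j then 1 else 0))"

definition tf_shift :: "(real^'n) \<times> (real^'n) \<Rightarrow> ((real^'n) \<Rightarrow> complex) \<Rightarrow> (real^'n) \<Rightarrow> complex" where
  "tf_shift z f t = exp (2 * of_real pi * \<i> * of_real (snd z \<bullet> t)) * f (t - fst z)"

definition stft :: "((real^'n) \<Rightarrow> complex) \<Rightarrow> ((real^'n) \<Rightarrow> complex) \<Rightarrow> (real^'n) \<times> (real^'n) \<Rightarrow> complex" where
  "stft \<phi> f z = L2_inner f (tf_shift z \<phi>)"

text \<open>
  The vector-valued integral is taken pointwise. For integrable \<open>F\<close> and \<open>\<phi> \<in> L\<^sup>2\<close>
  it converges absolutely for almost every \<open>t\<close> and agrees with the \<open>L\<^sup>2\<close>-valued integral.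
\<close>

definition stft_adjoint ::
  "((real^'n) \<Rightarrow> complex) \<Rightarrow> ((real^'n) \<times> (real^'n) \<Rightarrow> complex) \<Rightarrow> (real^'n) \<Rightarrow> complex" where
  "stft_adjoint \<phi> F t = (LINT z|lborel. F z * tf_shift z \<phi> t)"

definition localization_op ::
  "((real^'n) \<Rightarrow> complex) \<Rightarrow> ((real^'n) \<times> (real^'n) \<Rightarrow> real) \<Rightarrow> ((real^'n) \<Rightarrow> complex) \<Rightarrow> (real^'n) \<Rightarrow> complex" where
  "localization_op \<phi> \<sigma> f = stft_adjoint \<phi> (\<lambda>z. of_real (\<sigma> z) * stft \<phi> f z)"

definition gauss :: "(real^'n) \<Rightarrow> complex" where
  "gauss t = of_real (exp (- pi * (t \<bullet> t)))"

definition M1 :: "((real^'n) \<Rightarrow> complex) set" where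
  "M1 = {f \<in> L2. integrable lborel (\<lambda>z. cmod (stft gauss f z))}"

definition ess_support :: "((real^'n) \<times> (real^'n) \<Rightarrow> real) \<Rightarrow> ((real^'n) \<times> (real^'n)) set" where
  "ess_support \<sigma> =
     {z. \<forall>U. open U \<longrightarrow> z \<in> U \<longrightarrow> \<not> (AE w in lborel. w \<in> U \<longrightarrow> \<sigma> w = 0)}"

definition spectral_representation ::
  "(((real^'n) \<Rightarrow> complex) \<Rightarrow> (real^'n) \<Rightarrow> complex) \<Rightarrow> (nat \<Rightarrow> real) \<Rightarrow> (nat \<Rightarrow> (real^'n) \<Rightarrow> complex) \<Rightarrow> bool" where
  "spectral_representation H c e \<longleftrightarrow>
     (\<forall>j. c j > 0) \<and> summable c \<and> orthonormal_system e \<and>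
     (\<forall>j. AE t in lborel. H (e j) t = of_real (c j) * e j t) \<and>
     (\<forall>f\<in>L2. L2_sums (\<lambda>j t. of_real (c j) * L2_inner f (e j) * e j t) (H f))"

end

theory Submission
  imports Defs
begin

text \<open>
  Everything rests on the quadratic form of the localization operator,
  \<open>\<langle>H\<^sub>\<sigma> f, f\<rangle> = \<integral> \<sigma> |V\<^sub>\<phi> f|\<^sup>2\<close> (\<open>localization_op_quadratic_form\<close>). Applied to an
  eigenfunction \<open>e\<^sub>j\<close> it gives \<open>c\<^sub>j = \<integral> \<sigma> |V\<^sub>\<phi> e\<^sub>j|\<^sup>2\<close>. Let \<open>\<rho> = C \<chi>\<^sub>\<Omega> - \<sigma>\<close>, which is
  non-negative almost everywhere. Then
  \<open>C \<integral>\<^sub>\<Omega> |V\<^sub>\<phi> e\<^sub>j|\<^sup>2 - c\<^sub>j = \<integral> \<rho> |V\<^sub>\<phi> e\<^sub>j|\<^sup>2\<close> is non-negative, and it vanishes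
  exactly when \<open>\<rho> = 0\<close> or \<open>V\<^sub>\<phi> e\<^sub>j = 0\<close> at almost every point. The inequality, the
  sufficiency of \<open>\<rho> = 0\<close>, and its necessity when \<open>V\<^sub>\<phi> e\<^sub>j\<close> is nonzero almost
  everywhere on \<open>\<Omega>\<close> follow directly.

  If equality holds for all \<open>j\<close> and \<open>\<Omega>\<close> is contained in the essential support of \<open>\<sigma>\<close>
  up to a null set, it remains to exclude a point \<open>z\<close> of the essential support at which every
  \<open>V\<^sub>\<phi> e\<^sub>j\<close> vanishes (\<open>ess_support_imp_stft_eigenfunction_nonzero\<close>). At such a point
  \<open>f = \<pi>(z)\<phi>\<close> is orthogonal to all eigenfunctions, so \<open>H\<^sub>\<sigma> f = 0\<close> by the spectral
  representation, and the quadratic form shows that \<open>\<sigma> |V\<^sub>\<phi> f|\<^sup>2 = 0\<close> almost everywhere.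
  But \<open>V\<^sub>\<phi> f(z) = \<parallel>\<phi>\<parallel>\<^sup>2 \<noteq> 0\<close>, and \<open>V\<^sub>\<phi> f\<close> is continuous, so \<open>\<sigma>\<close> vanishes almost everywhere
  near \<open>z\<close>, a contradiction.

  The analytic ingredient is therefore the continuity of short-time Fourier transforms of
  \<open>L\<^sup>2\<close> functions (\<open>continuous_on_stft\<close>). It holds by dominated convergence for a bounded
  continuous window and an integrable signal, and passes to the general case because
  the transform depends continuously, uniformly in \<open>z\<close>, on both arguments in the
  \<open>L\<^sup>2\<close> norm and such windows and signals are dense.
\<close>

section \<open>Square-integrable functions\<close>

lemma borel_measurable_cnj [measurable (raw)]:
  "f \<in> borel_measurable M \<Longrightarrow> (\<lambda>x. cnj (f x)) \<in> borel_measurable M"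
  by (rule measurable_compose[OF _ borel_measurable_continuous_onI])
     (auto intro: continuous_intros)

lemma L2_measurable: "f \<in> L2 \<Longrightarrow> f \<in> borel_measurable borel"
  by (simp add: L2_def)

lemma L2_integrable_square: "f \<in> L2 \<Longrightarrow> integrable lborel (\<lambda>t. (cmod (f t))\<^sup>2)"
  by (simp add: L2_def)

lemma L2_norm_nonneg: "0 \<le> L2_norm f"
  by (simp add: L2_norm_def)

lemma L2_norm_square: "(L2_norm f)\<^sup>2 = (LINT t|lborel. (cmod (f t))\<^sup>2)"
  by (simp add: L2_norm_def)

lemma L2_norm_eq_0_imp_AE:
  assumes "f \<in> L2" "L2_norm f = 0"
  shows "AE t in lborel. f t = 0"
proof -
  have "(LINT t|lborel. (cmod (f t))\<^sup>2) = 0"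
    using assms(2) L2_norm_square[of f] by simp
  then have "AE t in lborel. (cmod (f t))\<^sup>2 = 0"
    using integral_nonneg_eq_0_iff_AE[OF L2_integrable_square[OF assms(1)]] by simp
  then show ?thesis by simp
qed

lemma L2_dominated:
  assumes "f \<in> L2" "g \<in> borel_measurable borel" "\<And>t. cmod (g t) \<le> cmod (f t)"
  shows "g \<in> L2"
proof -
  have "integrable lborel (\<lambda>t. (cmod (g t))\<^sup>2)"
  proof (rule Bochner_Integration.integrable_bound[OF L2_integrable_square[OF assms(1)]])
    show "(\<lambda>t. (cmod (g t))\<^sup>2) \<in> borel_measurable lborel" using assms(2) by simp
    show "AE t in lborel. norm ((cmod (g t))\<^sup>2) \<le> norm ((cmod (f t))\<^sup>2)"
      using assms(3) by (simp add: power_mono)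
  qed
  then show ?thesis using assms(2) by (simp add: L2_def)
qed

text \<open>
  Serves as a substitute for Minkowski's inequality: with the factor 2 it can be
  integrated termwise.
\<close>

lemma cmod_diff_square_le: "(cmod (a - b))\<^sup>2 \<le> 2 * (cmod a)\<^sup>2 + 2 * (cmod b)\<^sup>2"
proof -
  have "(cmod (a - b))\<^sup>2 \<le> (cmod a + cmod b)\<^sup>2"
    by (intro power_mono norm_triangle_ineq4) auto
  also have "\<dots> \<le> 2 * (cmod a)\<^sup>2 + 2 * (cmod b)\<^sup>2"
    using zero_le_power2[of "cmod a - cmod b"] by (simp add: power2_eq_square algebra_simps)
  finally show ?thesis .
qed

lemma L2_diff:
  assumes "f \<in> L2" "g \<in> L2"
  shows "(\<lambda>t. f t - g t) \<in> L2"
proof -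
  note [measurable] = L2_measurable[OF assms(1)] L2_measurable[OF assms(2)]
  have "integrable lborel (\<lambda>t. (cmod (f t - g t))\<^sup>2)"
  proof (rule Bochner_Integration.integrable_bound)
    show "integrable lborel (\<lambda>t. 2 * (cmod (f t))\<^sup>2 + 2 * (cmod (g t))\<^sup>2)"
      using assms by (simp add: L2_integrable_square)
    show "(\<lambda>t. (cmod (f t - g t))\<^sup>2) \<in> borel_measurable lborel" by measurable
    show "AE t in lborel. norm ((cmod (f t - g t))\<^sup>2)
        \<le> norm (2 * (cmod (f t))\<^sup>2 + 2 * (cmod (g t))\<^sup>2)"
      using cmod_diff_square_le by simp
  qed
  then show ?thesis by (simp add: L2_def)
qed

lemma integrable_cmod_mult_L2:
  assumes "f \<in> L2" "g \<in> L2"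
  shows "integrable lborel (\<lambda>t. cmod (f t) * cmod (g t))"
proof -
  note [measurable] = L2_measurable[OF assms(1)] L2_measurable[OF assms(2)]
  show ?thesis
  proof (rule Bochner_Integration.integrable_bound)
    show "integrable lborel (\<lambda>t. (cmod (f t))\<^sup>2 + (cmod (g t))\<^sup>2)"
      using assms by (simp add: L2_integrable_square)
    show "(\<lambda>t. cmod (f t) * cmod (g t)) \<in> borel_measurable lborel" by measurable
    show "AE t in lborel. norm (cmod (f t) * cmod (g t))
        \<le> norm ((cmod (f t))\<^sup>2 + (cmod (g t))\<^sup>2)"
    proof (rule AE_I2)
      fix t
      have "2 * (cmod (f t) * cmod (g t)) \<le> (cmod (f t))\<^sup>2 + (cmod (g t))\<^sup>2"
        using sum_squares_bound[of "cmod (f t)" "cmod (g t)"] by simp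
      moreover have "0 \<le> cmod (f t) * cmod (g t)" by simp
      ultimately show "norm (cmod (f t) * cmod (g t))
        \<le> norm ((cmod (f t))\<^sup>2 + (cmod (g t))\<^sup>2)"
        unfolding real_norm_def by linarith
    qed
  qed
qed

lemma integrable_mult_cnj_L2:
  assumes "f \<in> L2" "g \<in> L2"
  shows "integrable lborel (\<lambda>t. f t * cnj (g t))"
proof (rule Bochner_Integration.integrable_bound[OF integrable_cmod_mult_L2[OF assms]])
  note [measurable] = L2_measurable[OF assms(1)] L2_measurable[OF assms(2)]
  show "(\<lambda>t. f t * cnj (g t)) \<in> borel_measurable lborel" by measurable
qed (simp add: norm_mult)

text \<open>
  The weighted arithmetic-geometric inequality
  \<open>|f||g| \<le> q/(2p) |f|\<^sup>2 + p/(2q) |g|\<^sup>2\<close> with \<open>p = \<parallel>f\<parallel>\<close> and \<open>q = \<parallel>g\<parallel>\<close> integrates to \<open>p q\<close>.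
  The product of the absolute values is kept under the integral because the
  Fubini argument for the quadratic form needs a bound on the absolute integral.
\<close>

lemma L2_Cauchy_Schwarz:
  assumes f: "f \<in> L2" and g: "g \<in> L2"
  shows "(LINT t|lborel. cmod (f t) * cmod (g t)) \<le> L2_norm f * L2_norm g"
proof (cases "L2_norm f = 0 \<or> L2_norm g = 0")
  case True
  then have "AE t in lborel. f t = 0 \<or> g t = 0"
    using L2_norm_eq_0_imp_AE[OF f] L2_norm_eq_0_imp_AE[OF g] by auto
  then have "AE t in lborel. cmod (f t) * cmod (g t) = 0"
    by eventually_elim auto
  then have "(LINT t|lborel. cmod (f t) * cmod (g t)) = 0"
    by (rule integral_eq_zero_AE)
  then show ?thesis by (simp add: L2_norm_nonneg)
next
  case False
  define p q where "p = L2_norm f" and "q = L2_norm g"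
  have p: "0 < p" and q: "0 < q"
    using False L2_norm_nonneg[of f] L2_norm_nonneg[of g] by (auto simp: p_def q_def)
  have le: "x * y \<le> q / (2 * p) * x\<^sup>2 + p / (2 * q) * y\<^sup>2" for x y :: real
  proof -
    have "0 \<le> (q * x - p * y)\<^sup>2 / (2 * p * q)" using p q by simp
    also have "\<dots> = q / (2 * p) * x\<^sup>2 + p / (2 * q) * y\<^sup>2 - x * y"
      using p q by (simp add: field_simps power2_eq_square)
    finally show ?thesis by simp
  qed
  have "(LINT t|lborel. cmod (f t) * cmod (g t))
      \<le> (LINT t|lborel. q / (2 * p) * (cmod (f t))\<^sup>2 + p / (2 * q) * (cmod (g t))\<^sup>2)"
    by (intro integral_mono integrable_cmod_mult_L2 f g le Bochner_Integration.integrable_add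
        integrable_mult_right L2_integrable_square)
  also have "\<dots> = q / (2 * p) * p\<^sup>2 + p / (2 * q) * q\<^sup>2"
    using f g by (simp add: L2_integrable_square p_def q_def L2_norm_square)
  also have "\<dots> = p * q"
    using p q by (simp add: field_simps power2_eq_square)
  finally show ?thesis by (simp add: p_def q_def)
qed

lemma cmod_L2_inner_le:
  assumes "f \<in> L2" "g \<in> L2"
  shows "cmod (L2_inner f g) \<le> L2_norm f * L2_norm g"
proof -
  have "cmod (L2_inner f g) \<le> (LINT t|lborel. norm (f t * cnj (g t)))"
    unfolding L2_inner_def by (rule integral_norm_bound)
  then show ?thesis
    using L2_Cauchy_Schwarz[OF assms] by (simp add: norm_mult)
qed

lemma L2_inner_self: "L2_inner f f = of_real ((L2_norm f)\<^sup>2)"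
proof -
  have "L2_inner f f = (LINT t|lborel. complex_of_real ((cmod (f t))\<^sup>2))"
    unfolding L2_inner_def by (simp only: complex_norm_square)
  then show ?thesis by (simp only: integral_complex_of_real L2_norm_square)
qed

lemma L2_inner_commute: "L2_inner g f = cnj (L2_inner f g)"
proof -
  have "L2_inner g f = (LINT t|lborel. cnj (f t * cnj (g t)))"
    by (simp add: L2_inner_def mult.commute)
  also have "\<dots> = cnj (L2_inner f g)"
    unfolding L2_inner_def by (rule Bochner_Integration.integral_cnj)
  finally show ?thesis .
qed

lemma L2_inner_diff_left:
  assumes "f \<in> L2" "g \<in> L2" "h \<in> L2"
  shows "L2_inner (\<lambda>t. f t - g t) h = L2_inner f h - L2_inner g h"
  unfolding L2_inner_def using integrable_mult_cnj_L2[OF assms(1,3)] integrable_mult_cnj_L2[OF assms(2,3)]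
  by (simp add: left_diff_distrib)

lemma L2_inner_diff_right:
  assumes "f \<in> L2" "g \<in> L2" "h \<in> L2"
  shows "L2_inner f (\<lambda>t. g t - h t) = L2_inner f g - L2_inner f h"
  unfolding L2_inner_def using integrable_mult_cnj_L2[OF assms(1,2)] integrable_mult_cnj_L2[OF assms(1,3)]
  by (simp add: right_diff_distrib)

section \<open>Time-frequency shifts\<close>

lemma has_bochner_integral_lborel_translation:
  fixes f :: "'a::euclidean_space \<Rightarrow> real"
  assumes "integrable lborel f"
  shows "has_bochner_integral lborel (\<lambda>t. f (t - a)) (integral\<^sup>L lborel f)"
proof -
  have [measurable]: "f \<in> borel_measurable borel"
    using borel_measurable_integrable[OF assms] by simp
  have "integrable (distr lborel borel ((+) (- a))) f"
    using assms by (simp add: lborel_distr_plus)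
  then have 1: "integrable lborel (\<lambda>t. f (t - a))"
    by (subst (asm) integrable_distr_eq) auto
  have "integral\<^sup>L lborel f = integral\<^sup>L (distr lborel borel ((+) (- a))) f"
    by (simp add: lborel_distr_plus)
  also have "\<dots> = (LINT t|lborel. f (t - a))"
    by (subst integral_distr) auto
  finally show ?thesis using 1 by (simp add: has_bochner_integral_iff)
qed

lemma cmod_tf_shift: "cmod (tf_shift z \<phi> t) = cmod (\<phi> (t - fst z))"
  by (simp add: tf_shift_def norm_mult)

lemma borel_measurable_tf_shift:
  fixes \<phi> :: "(real^'n) \<Rightarrow> complex"
  assumes [measurable]: "\<phi> \<in> borel_measurable borel"
  shows "(\<lambda>p. tf_shift (fst p) \<phi> (snd p)) \<in> borel_measurable (lborel \<Otimes>\<^sub>M lborel)"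
proof -
  have "(\<lambda>p :: ((real^'n) \<times> (real^'n)) \<times> (real^'n).
      exp (2 * of_real pi * \<i> * complex_of_real (snd (fst p) \<bullet> snd p))) \<in> borel_measurable borel"
    by (intro borel_measurable_continuous_onI continuous_intros)
  moreover have "(\<lambda>p :: ((real^'n) \<times> (real^'n)) \<times> (real^'n). \<phi> (snd p - fst (fst p)))
      \<in> borel_measurable borel"
    by (rule measurable_compose[OF borel_measurable_continuous_onI assms])
       (intro continuous_intros)
  ultimately show ?thesis
    unfolding tf_shift_def lborel_prod by simp
qed

lemma tf_shift_L2:
  assumes "\<phi> \<in> L2"
  shows "tf_shift z \<phi> \<in> L2" and "L2_norm (tf_shift z \<phi>) = L2_norm \<phi>"
proof -
  note [measurable] = L2_measurable[OF assms]
  have "tf_shift z \<phi> \<in> borel_measurable borel"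
    unfolding tf_shift_def by measurable
  then show "tf_shift z \<phi> \<in> L2" "L2_norm (tf_shift z \<phi>) = L2_norm \<phi>"
    using has_bochner_integral_lborel_translation[OF L2_integrable_square[OF assms], of "fst z"]
    by (simp_all add: L2_def L2_norm_def cmod_tf_shift has_bochner_integral_iff)
qed

lemma cmod_stft_le:
  assumes "\<phi> \<in> L2" "f \<in> L2"
  shows "cmod (stft \<phi> f z) \<le> L2_norm f * L2_norm \<phi>"
  using cmod_L2_inner_le[OF assms(2) tf_shift_L2(1)[OF assms(1)]]
  by (simp add: stft_def tf_shift_L2(2)[OF assms(1)])

section \<open>Density of continuous functions\<close>

text \<open>
  Negligible sets need not be Borel, but they lie in Borel null sets.
\<close>

lemma AE_lborel_of_negligible:
  assumes "negligible N" "\<And>t. t \<notin> N \<Longrightarrow> P t"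
  shows "AE t in lborel. P t"
proof -
  have "N \<in> null_sets (completion lborel)"
    using assms(1) by (simp add: negligible_iff_null_sets)
  then obtain N' where "N' \<in> null_sets lborel" "N \<subseteq> N'"
    by (auto simp: null_sets_completion_iff2)
  then show ?thesis
    using assms(2) by (intro AE_I'[of N']) auto
qed

text \<open>
  Every measurable function is almost everywhere a limit of continuous functions.
  Projecting these onto the closed ball of radius \<open>B\<close> keeps them continuous, does not
  change the limit, and makes them uniformly bounded, as dominated convergence requires.
\<close>

lemma bounded_borel_limit_of_continuous:
  fixes f :: "'a::euclidean_space \<Rightarrow> complex"
  assumes f: "f \<in> borel_measurable borel" and B: "\<And>t. cmod (f t) \<le> B"
  obtains g where "\<And>n::nat. continuous_on UNIV (g n)" "\<And>n t. cmod (g n t) \<le> B"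
    "AE t in lborel. (\<lambda>n. g n t) \<longlonglongrightarrow> f t"
proof -
  have "f \<in> borel_measurable lebesgue"
    using f by (intro measurable_completion) simp
  then have "f measurable_on UNIV"
    by (intro lebesgue_measurable_imp_measurable_on) (auto simp: lebesgue_on_UNIV_eq)
  then obtain N g where N: "negligible N" and g: "\<And>n::nat. continuous_on UNIV (g n)"
    and lim: "\<And>t. t \<notin> N \<Longrightarrow> (\<lambda>n. g n t) \<longlonglongrightarrow> f t"
    by (auto simp: measurable_on_def)
  have "0 \<le> B" using B[of 0] norm_ge_zero order_trans by blast
  then have ne: "cball (0::complex) B \<noteq> {}" by simp
  define P where "P = closest_point (cball (0::complex) B)"
  have contP: "continuous_on UNIV P"
    unfolding P_def using ne by (intro continuous_on_closest_point) auto
  have P_le: "cmod (P w) \<le> B" for w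
    using closest_point_in_set[of "cball (0::complex) B" w] ne by (simp add: P_def dist_norm)
  have P_f: "P (f t) = f t" for t
    unfolding P_def using B by (intro closest_point_self) (simp add: dist_norm)
  show thesis
  proof (rule that)
    show "continuous_on UNIV (\<lambda>t. P (g n t))" for n
      by (rule continuous_on_compose2[OF contP g]) auto
    show "cmod (P (g n t)) \<le> B" for n t by (rule P_le)
    show "AE t in lborel. (\<lambda>n. P (g n t)) \<longlonglongrightarrow> f t"
    proof (rule AE_lborel_of_negligible[OF N])
      fix t assume "t \<notin> N"
      then have "(\<lambda>n. P (g n t)) \<longlonglongrightarrow> P (f t)"
        by (intro continuous_on_tendsto_compose[OF contP] lim) auto
      then show "(\<lambda>n. P (g n t)) \<longlonglongrightarrow> f t" by (simp add: P_f)
    qed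
  qed
qed

lemma L2_dominated_convergence:
  fixes b h :: "(real^'n) \<Rightarrow> complex"
  assumes b: "b \<in> L2" and h: "h \<in> borel_measurable borel"
    and hn: "\<And>n::nat. hn n \<in> borel_measurable borel"
    and h_le: "\<And>t. cmod (h t) \<le> cmod (b t)" and hn_le: "\<And>n t. cmod (hn n t) \<le> cmod (b t)"
    and lim: "AE t in lborel. (\<lambda>n. hn n t) \<longlonglongrightarrow> h t"
  shows "(\<lambda>n. L2_norm (\<lambda>t. h t - hn n t)) \<longlonglongrightarrow> 0"
proof -
  note [measurable] = h hn
  have "(\<lambda>n. LINT t|lborel. (cmod (h t - hn n t))\<^sup>2) \<longlonglongrightarrow> (LINT t::real^'n|lborel. 0)"
  proof (rule integral_dominated_convergence)
    show "integrable lborel (\<lambda>t. 4 * (cmod (b t))\<^sup>2)"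
      using L2_integrable_square[OF b] by simp
    show "AE t in lborel. (\<lambda>n. (cmod (h t - hn n t))\<^sup>2) \<longlonglongrightarrow> 0"
      using lim
    proof eventually_elim
      fix t assume "(\<lambda>n. hn n t) \<longlonglongrightarrow> h t"
      then have "(\<lambda>n. (cmod (h t - hn n t))\<^sup>2) \<longlonglongrightarrow> (cmod (h t - h t))\<^sup>2"
        by (intro tendsto_intros)
      then show "(\<lambda>n. (cmod (h t - hn n t))\<^sup>2) \<longlonglongrightarrow> 0" by simp
    qed
    show "AE t in lborel. norm ((cmod (h t - hn n t))\<^sup>2) \<le> 4 * (cmod (b t))\<^sup>2" for n
    proof (rule AE_I2)
      fix t
      have "(cmod (h t))\<^sup>2 \<le> (cmod (b t))\<^sup>2" "(cmod (hn n t))\<^sup>2 \<le> (cmod (b t))\<^sup>2"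
        using h_le hn_le by (auto intro: power_mono)
      then show "norm ((cmod (h t - hn n t))\<^sup>2) \<le> 4 * (cmod (b t))\<^sup>2"
        using cmod_diff_square_le[of "h t" "hn n t"] unfolding real_norm_def abs_power2 by linarith
    qed
  qed auto
  then have "(\<lambda>n. sqrt (LINT t|lborel. (cmod (h t - hn n t))\<^sup>2)) \<longlonglongrightarrow> sqrt 0"
    by (intro tendsto_real_sqrt) simp
  then show ?thesis by (simp add: L2_norm_def)
qed

lemma L2_norm_diff_less:
  assumes f: "f \<in> L2" and g: "g \<in> L2" and h: "h \<in> L2"
    and fg: "L2_norm (\<lambda>t. f t - g t) < \<epsilon> / 2" and gh: "L2_norm (\<lambda>t. g t - h t) < \<epsilon> / 2"
  shows "L2_norm (\<lambda>t. f t - h t) < \<epsilon>"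
proof -
  have hg: "L2_norm (\<lambda>t. h t - g t) < \<epsilon> / 2"
    using gh by (simp add: L2_norm_def norm_minus_commute)
  have \<epsilon>: "0 < \<epsilon>"
    using fg L2_norm_nonneg[of "\<lambda>t. f t - g t"] by linarith
  have sq: "(L2_norm k)\<^sup>2 < \<epsilon>\<^sup>2 / 4" if "L2_norm k < \<epsilon> / 2" for k :: "(real^'a) \<Rightarrow> complex"
    using power_strict_mono[OF that L2_norm_nonneg, of 2] by (simp add: power_divide)
  have "(L2_norm (\<lambda>t. f t - h t))\<^sup>2
      \<le> (LINT t|lborel. 2 * (cmod (f t - g t))\<^sup>2 + 2 * (cmod (h t - g t))\<^sup>2)"
    unfolding L2_norm_square
  proof (rule integral_mono)
    show "(cmod (f t - h t))\<^sup>2 \<le> 2 * (cmod (f t - g t))\<^sup>2 + 2 * (cmod (h t - g t))\<^sup>2" for t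
      using cmod_diff_square_le[of "f t - g t" "h t - g t"] by simp
  qed (intro L2_integrable_square L2_diff f g h Bochner_Integration.integrable_add
      integrable_mult_right)+
  also have "\<dots> = 2 * (L2_norm (\<lambda>t. f t - g t))\<^sup>2 + 2 * (L2_norm (\<lambda>t. h t - g t))\<^sup>2"
    using L2_integrable_square[OF L2_diff[OF f g]] L2_integrable_square[OF L2_diff[OF h g]]
    by (simp add: L2_norm_square)
  also have "\<dots> < \<epsilon>\<^sup>2"
    using sq[OF fg] sq[OF hg] by linarith
  finally show ?thesis
    by (rule power2_less_imp_less) (simp add: less_imp_le[OF \<epsilon>])
qed

text \<open>
  Two truncations make dominated convergence available. Cutting \<open>\<phi>\<close> off in size and in
  space gives bounded functions \<open>\<psi> n\<close> of bounded support, dominated by \<open>\<phi>\<close> itself. A fixed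
  \<open>\<psi> n\<close> is an almost everywhere limit of bounded continuous functions. Multiplied by a
  continuous cutoff \<open>\<kappa>\<close> these are dominated by a multiple \<open>b\<close> of the indicator of a ball,
  while the limit is unaffected because \<open>\<kappa> = 1\<close> on the support of \<open>\<psi> n\<close>.
\<close>

lemma L2_continuous_dense:
  fixes \<phi> :: "(real^'n) \<Rightarrow> complex"
  assumes \<phi>: "\<phi> \<in> L2" and \<epsilon>: "0 < \<epsilon>"
  obtains g B where "continuous_on UNIV g" "\<And>t. cmod (g t) \<le> B" "integrable lborel g" "g \<in> L2"
    "L2_norm (\<lambda>t. \<phi> t - g t) < \<epsilon>"
proof -
  note [measurable] = L2_measurable[OF \<phi>]
  define \<psi> where "\<psi> n t = (if norm t \<le> real n \<and> cmod (\<phi> t) \<le> real n then \<phi> t else 0)" for n t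
  have \<psi>_measurable [measurable]: "\<psi> n \<in> borel_measurable borel" for n
    unfolding \<psi>_def by measurable
  have \<psi>_le_\<phi>: "cmod (\<psi> n t) \<le> cmod (\<phi> t)" and \<psi>_le: "cmod (\<psi> n t) \<le> real n" for n t
    by (auto simp: \<psi>_def)
  have "(\<lambda>n. \<psi> n t) \<longlonglongrightarrow> \<phi> t" for t
  proof -
    obtain m where m: "max (norm t) (cmod (\<phi> t)) \<le> real m"
      using real_arch_simple by blast
    then have "\<psi> n t = \<phi> t" if "m \<le> n" for n
    proof -
      have "real m \<le> real n" using that by simp
      then show ?thesis using m by (auto simp: \<psi>_def)
    qed
    then show ?thesis
      by (intro tendsto_eventually eventually_sequentiallyI[of m])
  qed
  then have "(\<lambda>n. L2_norm (\<lambda>t. \<phi> t - \<psi> n t)) \<longlonglongrightarrow> 0"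
    by (intro L2_dominated_convergence[OF \<phi>]) (auto simp: \<psi>_le_\<phi>)
  then have "eventually (\<lambda>n. L2_norm (\<lambda>t. \<phi> t - \<psi> n t) < \<epsilon> / 2) sequentially"
    using \<epsilon> by (intro order_tendstoD) auto
  then obtain n where n: "L2_norm (\<lambda>t. \<phi> t - \<psi> n t) < \<epsilon> / 2"
    by (auto simp: eventually_sequentially)
  obtain g where g: "\<And>k::nat. continuous_on UNIV (g k)" and g_le: "\<And>k t. cmod (g k t) \<le> real n"
    and lim: "AE t in lborel. (\<lambda>k. g k t) \<longlonglongrightarrow> \<psi> n t"
    using bounded_borel_limit_of_continuous[OF \<psi>_measurable \<psi>_le, of n] by blast
  \<comment> \<open>\<open>\<kappa>\<close> falls from 1 on the ball of radius \<open>n\<close> to 0 outside the ball of radius \<open>n + 1\<close>.\<close>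
  define \<kappa> where "\<kappa> t = max 0 (min 1 (real n + 1 - norm t))" for t :: "real^'n"
  define h where "h k t = complex_of_real (\<kappa> t) * g k t" for k t
  define b where "b t = (of_real (real n * indicator (cball 0 (real n + 1)) t) :: complex)" for t :: "real^'n"
  have \<psi>_\<kappa>: "complex_of_real (\<kappa> t) * \<psi> n t = \<psi> n t" for t
    by (simp add: \<psi>_def \<kappa>_def)
  have h_cont: "continuous_on UNIV (h k)" for k
    unfolding h_def \<kappa>_def by (intro continuous_intros g)
  have h_measurable [measurable]: "h k \<in> borel_measurable borel" for k
    by (intro borel_measurable_continuous_onI h_cont)
  have fin: "emeasure lborel (cball (0::real^'n) (real n + 1)) < \<infinity>"
    by (rule emeasure_lborel_cball_finite)
  have b_sq: "(cmod (b t))\<^sup>2 = (real n)\<^sup>2 * indicator (cball 0 (real n + 1)) t" for t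
    by (simp add: b_def indicator_def)
  have b_int: "integrable lborel b"
    unfolding b_def using fin by (intro integrable_of_real integrable_mult_right integrable_real_indicator) auto
  have "integrable lborel (\<lambda>t. (cmod (b t))\<^sup>2)"
    unfolding b_sq using fin by (intro integrable_mult_right integrable_real_indicator) auto
  then have b: "b \<in> L2"
    using borel_measurable_integrable[OF b_int] by (simp add: L2_def)
  have h_le_b: "cmod (h k t) \<le> cmod (b t)" for k t
  proof (cases "norm t \<le> real n + 1")
    case True
    then have "cmod (h k t) = \<kappa> t * cmod (g k t)"
      by (simp add: h_def norm_mult \<kappa>_def)
    also have "\<dots> \<le> 1 * real n"
      by (intro mult_mono g_le) (auto simp: \<kappa>_def)
    finally show ?thesis using True by (simp add: b_def dist_norm)
  next
    case False
    then show ?thesis by (simp add: h_def \<kappa>_def)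
  qed
  have "(\<lambda>k. L2_norm (\<lambda>t. \<psi> n t - h k t)) \<longlonglongrightarrow> 0"
  proof (rule L2_dominated_convergence[OF b \<psi>_measurable h_measurable _ h_le_b])
    show "cmod (\<psi> n t) \<le> cmod (b t)" for t
      by (auto simp: \<psi>_def b_def dist_norm)
    show "AE t in lborel. (\<lambda>k. h k t) \<longlonglongrightarrow> \<psi> n t"
      using lim
    proof eventually_elim
      fix t assume "(\<lambda>k. g k t) \<longlonglongrightarrow> \<psi> n t"
      then have "(\<lambda>k. h k t) \<longlonglongrightarrow> complex_of_real (\<kappa> t) * \<psi> n t"
        unfolding h_def by (intro tendsto_intros)
      then show "(\<lambda>k. h k t) \<longlonglongrightarrow> \<psi> n t" by (simp only: \<psi>_\<kappa>)
    qed
  qed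
  then have "eventually (\<lambda>k. L2_norm (\<lambda>t. \<psi> n t - h k t) < \<epsilon> / 2) sequentially"
    using \<epsilon> by (intro order_tendstoD) auto
  then obtain k where k: "L2_norm (\<lambda>t. \<psi> n t - h k t) < \<epsilon> / 2"
    by (auto simp: eventually_sequentially)
  have h_L2: "h k \<in> L2"
    by (rule L2_dominated[OF b h_measurable h_le_b])
  have "\<psi> n \<in> L2"
    by (rule L2_dominated[OF \<phi> \<psi>_measurable \<psi>_le_\<phi>])
  then have "L2_norm (\<lambda>t. \<phi> t - h k t) < \<epsilon>"
    using L2_norm_diff_less[OF \<phi> _ h_L2 n k] by simp
  moreover have "cmod (h k t) \<le> real n" for t
    using h_le_b[of k t] by (rule order_trans) (simp add: b_def indicator_def)
  moreover have "integrable lborel (h k)"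
    by (rule Bochner_Integration.integrable_bound[OF b_int]) (use h_le_b in auto)
  ultimately show thesis
    using h_L2 by (intro that[OF h_cont])
qed

section \<open>Continuity of the short-time Fourier transform\<close>

text \<open>
  The integrand is continuous in \<open>z\<close> for fixed \<open>t\<close> and dominated by \<open>B |f t|\<close>.
\<close>

lemma continuous_on_stft_of_bounded_window:
  fixes \<phi> f :: "(real^'n) \<Rightarrow> complex"
  assumes \<phi>: "continuous_on UNIV \<phi>" and B: "\<And>t. cmod (\<phi> t) \<le> B" and f: "integrable lborel f"
  shows "continuous_on UNIV (stft \<phi> f)"
proof -
  have [measurable]: "f \<in> borel_measurable borel" "\<phi> \<in> borel_measurable borel"
    using borel_measurable_integrable[OF f] borel_measurable_continuous_onI[OF \<phi>] by auto
  have [measurable]: "tf_shift z \<phi> \<in> borel_measurable borel" for z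
    unfolding tf_shift_def by measurable
  have "(\<lambda>n. stft \<phi> f (x n)) \<longlonglongrightarrow> stft \<phi> f a" if x: "x \<longlonglongrightarrow> a" for x a
    unfolding stft_def L2_inner_def
  proof (rule integral_dominated_convergence)
    show "integrable lborel (\<lambda>t. cmod (f t) * B)"
      using f by simp
    show "AE t in lborel. (\<lambda>n. f t * cnj (tf_shift (x n) \<phi> t)) \<longlonglongrightarrow> f t * cnj (tf_shift a \<phi> t)"
    proof (rule AE_I2)
      fix t
      have "(\<lambda>n. \<phi> (t - fst (x n))) \<longlonglongrightarrow> \<phi> (t - fst a)"
        by (rule continuous_on_tendsto_compose[OF \<phi>]) (auto intro!: tendsto_intros x)
      then show "(\<lambda>n. f t * cnj (tf_shift (x n) \<phi> t)) \<longlonglongrightarrow> f t * cnj (tf_shift a \<phi> t)"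
        unfolding tf_shift_def by (intro tendsto_intros x)
    qed
    show "AE t in lborel. norm (f t * cnj (tf_shift (x n) \<phi> t)) \<le> cmod (f t) * B" for n
      using B by (auto simp: norm_mult cmod_tf_shift intro!: mult_left_mono)
  qed measurable
  then show ?thesis
    by (simp add: continuous_on_sequentially o_def)
qed

text \<open>
  By sesquilinearity the difference is \<open>V\<close> of \<open>f\<close> with window \<open>\<phi> - g\<close> plus \<open>V\<close> of \<open>f - h\<close>
  with window \<open>g\<close>. The bound does not depend on \<open>z\<close>.
\<close>

lemma cmod_stft_diff_le:
  assumes "\<phi> \<in> L2" "g \<in> L2" "f \<in> L2" "h \<in> L2"
  shows "cmod (stft \<phi> f z - stft g h z)
    \<le> L2_norm f * L2_norm (\<lambda>t. \<phi> t - g t) + L2_norm (\<lambda>t. f t - h t) * L2_norm g"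
proof -
  have shift_diff: "tf_shift z (\<lambda>t. \<phi> t - g t) = (\<lambda>t. tf_shift z \<phi> t - tf_shift z g t)"
    by (simp add: tf_shift_def fun_eq_iff right_diff_distrib)
  have "stft \<phi> f z - stft g h z
      = stft (\<lambda>t. \<phi> t - g t) f z + stft g (\<lambda>t. f t - h t) z"
    using assms
    by (simp add: stft_def shift_diff L2_inner_diff_left L2_inner_diff_right tf_shift_L2)
  then have "cmod (stft \<phi> f z - stft g h z)
      \<le> cmod (stft (\<lambda>t. \<phi> t - g t) f z) + cmod (stft g (\<lambda>t. f t - h t) z)"
    by (simp add: norm_triangle_ineq)
  then show ?thesis
    using cmod_stft_le[OF L2_diff[OF assms(1,2)] assms(3), of z]
      cmod_stft_le[OF assms(2) L2_diff[OF assms(3,4)], of z] by linarith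
qed

text \<open>
  The window is approximated first and the signal second, because the second error is
  multiplied by the norm of the approximate window.
\<close>

lemma stft_uniform_approx:
  fixes \<phi> f :: "(real^'n) \<Rightarrow> complex"
  assumes \<phi>: "\<phi> \<in> L2" and f: "f \<in> L2" and \<epsilon>: "0 < \<epsilon>"
  shows "\<exists>v. continuous_on UNIV v \<and> (\<forall>z. cmod (v z - stft \<phi> f z) < \<epsilon>)"
proof -
  have small_factor: "0 < \<epsilon> / (2 * (x + 1)) \<and> x * (\<epsilon> / (2 * (x + 1))) < \<epsilon> / 2"
    if "0 < \<epsilon>" "0 \<le> x" for x :: real
  proof -
    have "x * (\<epsilon> / (2 * (x + 1))) = (x / (x + 1)) * (\<epsilon> / 2)" by simp
    also have "\<dots> < 1 * (\<epsilon> / 2)"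
      using that by (intro mult_strict_right_mono) auto
    finally show ?thesis using that by simp
  qed
  \<comment> \<open>The \<open>+ 1\<close> keeps the denominators positive when a norm is 0.\<close>
  define \<delta> where "\<delta> = \<epsilon> / (2 * (L2_norm f + 1))"
  have \<delta>: "0 < \<delta>" "L2_norm f * \<delta> < \<epsilon> / 2"
    using small_factor[OF \<epsilon> L2_norm_nonneg[of f]] by (simp_all add: \<delta>_def mult.commute)
  obtain g B where g: "continuous_on UNIV g" "\<And>t. cmod (g t) \<le> B" "g \<in> L2"
    and g_near: "L2_norm (\<lambda>t. \<phi> t - g t) < \<delta>"
    using L2_continuous_dense[OF \<phi> \<delta>(1)] by blast
  define \<eta> where "\<eta> = \<epsilon> / (2 * (L2_norm g + 1))"
  have \<eta>: "0 < \<eta>" "\<eta> * L2_norm g < \<epsilon> / 2"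
    using small_factor[OF \<epsilon> L2_norm_nonneg[of g]] by (simp_all add: \<eta>_def mult.commute)
  obtain h where h: "integrable lborel h" "h \<in> L2" and h_near: "L2_norm (\<lambda>t. f t - h t) < \<eta>"
    using L2_continuous_dense[OF f \<eta>(1)] by blast
  have "cmod (stft g h z - stft \<phi> f z) < \<epsilon>" for z
  proof -
    have "L2_norm f * L2_norm (\<lambda>t. \<phi> t - g t) \<le> L2_norm f * \<delta>"
      "L2_norm (\<lambda>t. f t - h t) * L2_norm g \<le> \<eta> * L2_norm g"
      using g_near h_near by (auto intro!: mult_left_mono mult_right_mono simp: L2_norm_nonneg)
    then show ?thesis
      using cmod_stft_diff_le[OF \<phi> g(3) f h(2), of z] \<delta>(2) \<eta>(2)
      by (simp add: norm_minus_commute)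
  qed
  then show ?thesis
    using continuous_on_stft_of_bounded_window[OF g(1,2) h(1)] by blast
qed

lemma continuous_on_stft:
  fixes \<phi> f :: "(real^'n) \<Rightarrow> complex"
  assumes "\<phi> \<in> L2" "f \<in> L2"
  shows "continuous_on UNIV (stft \<phi> f)"
proof -
  have "\<forall>n. \<exists>v. continuous_on UNIV v \<and> (\<forall>z. cmod (v z - stft \<phi> f z) < 1 / real (Suc n))"
    using stft_uniform_approx[OF assms] by simp
  then obtain v where v: "\<And>n. continuous_on UNIV (v n)"
    and near: "\<And>n z. cmod (v n z - stft \<phi> f z) < 1 / real (Suc n)"
    by metis
  have lim: "uniform_limit UNIV v (stft \<phi> f) sequentially"
  proof (rule uniform_limitI)
    fix \<epsilon> :: real assume "0 < \<epsilon>"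
    then have "eventually (\<lambda>n. 1 / real (Suc n) < \<epsilon>) sequentially"
      using order_tendstoD(2)[OF LIMSEQ_Suc[OF lim_inverse_n']] by simp
    then show "\<forall>\<^sub>F n in sequentially. \<forall>z\<in>UNIV. dist (v n z) (stft \<phi> f z) < \<epsilon>"
    proof eventually_elim
      fix n assume "1 / real (Suc n) < \<epsilon>"
      then show "\<forall>z\<in>UNIV. dist (v n z) (stft \<phi> f z) < \<epsilon>"
        unfolding dist_norm using near less_trans by blast
    qed
  qed
  show ?thesis
    using v by (intro uniform_limit_theorem[OF _ lim]) auto
qed

section \<open>The quadratic form of the localization operator\<close>

text \<open>
  Exchanging the two integrals turns \<open>\<langle>\<integral> \<sigma> V\<^sub>\<phi> f(z) \<pi>(z)\<phi> dz, f\<rangle>\<close> into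
  \<open>\<integral> \<sigma> V\<^sub>\<phi> f(z) \<langle>\<pi>(z)\<phi>, f\<rangle> dz\<close>, and the inner product is the conjugate of \<open>V\<^sub>\<phi> f(z)\<close>.
  Fubini applies because two uses of Cauchy-Schwarz bound the absolute integral over \<open>t\<close> by
  \<open>|\<sigma> z| (\<parallel>f\<parallel> \<parallel>\<phi>\<parallel>)\<^sup>2\<close>.
\<close>

lemma localization_op_quadratic_form:
  fixes \<phi> f :: "(real^'n) \<Rightarrow> complex"
  assumes \<sigma>: "integrable lborel \<sigma>" and \<phi>: "\<phi> \<in> L2" and f: "f \<in> L2"
  shows "L2_inner (localization_op \<phi> \<sigma> f) f
    = of_real (LINT z|lborel. \<sigma> z * (cmod (stft \<phi> f z))\<^sup>2)"
proof -
  define K where "K z t = of_real (\<sigma> z) * stft \<phi> f z * tf_shift z \<phi> t * cnj (f t)" for z t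
  note [measurable] = L2_measurable[OF \<phi>] L2_measurable[OF f] borel_measurable_tf_shift
  have [measurable]: "\<sigma> \<in> borel_measurable borel"
    using borel_measurable_integrable[OF \<sigma>] by simp
  have V[measurable]: "stft \<phi> f \<in> borel_measurable borel"
    by (intro borel_measurable_continuous_onI continuous_on_stft \<phi> f)
  have K_measurable: "case_prod K \<in> borel_measurable (lborel \<Otimes>\<^sub>M lborel)"
    unfolding K_def case_prod_unfold by measurable
  have K_norm: "norm (K z t) = \<bar>\<sigma> z\<bar> * cmod (stft \<phi> f z) * (cmod (f t) * cmod (tf_shift z \<phi> t))" for z t
    by (simp add: K_def norm_mult)
  have K_int: "integrable (lborel \<Otimes>\<^sub>M lborel) (case_prod K)"
  proof (rule lborel_pair.Fubini_integrable[OF K_measurable])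
    show "AE z in lborel. integrable lborel (\<lambda>t. case (z, t) of (z, t) \<Rightarrow> K z t)"
    proof (rule AE_I2)
      fix z
      have "integrable lborel (\<lambda>t. of_real (\<sigma> z) * stft \<phi> f z * (tf_shift z \<phi> t * cnj (f t)))"
        by (intro integrable_mult_right integrable_mult_cnj_L2 tf_shift_L2 \<phi> f)
      then show "integrable lborel (\<lambda>t. case (z, t) of (z, t) \<Rightarrow> K z t)"
        by (simp add: K_def mult.assoc)
    qed
    define M where "M = L2_norm f * L2_norm \<phi>"
    have "integrable lborel (\<lambda>z. LINT t|lborel. norm (K z t))"
    proof (rule Bochner_Integration.integrable_bound)
      show "integrable lborel (\<lambda>z. \<sigma> z * (M * M))"
        using \<sigma> by simp
      show "(\<lambda>z. LINT t|lborel. norm (K z t)) \<in> borel_measurable lborel"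
        using K_measurable by (intro lborel.borel_measurable_lebesgue_integral) (simp add: case_prod_unfold)
      show "AE z in lborel. norm (LINT t|lborel. norm (K z t)) \<le> norm (\<sigma> z * (M * M))"
      proof (rule AE_I2)
        fix z
        have "(LINT t|lborel. cmod (f t) * cmod (tf_shift z \<phi> t)) \<le> M"
          using L2_Cauchy_Schwarz[OF f tf_shift_L2(1)[OF \<phi>]] by (simp add: M_def tf_shift_L2(2)[OF \<phi>])
        moreover have "0 \<le> (LINT t|lborel. cmod (f t) * cmod (tf_shift z \<phi> t))"
          by simp
        moreover have "cmod (stft \<phi> f z) \<le> M"
          unfolding M_def by (rule cmod_stft_le[OF \<phi> f])
        ultimately have "cmod (stft \<phi> f z) * (LINT t|lborel. cmod (f t) * cmod (tf_shift z \<phi> t)) \<le> M * M"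
          by (intro mult_mono) (auto intro: order_trans[OF norm_ge_zero])
        moreover have "(LINT t|lborel. norm (K z t))
            = \<bar>\<sigma> z\<bar> * (cmod (stft \<phi> f z) * (LINT t|lborel. cmod (f t) * cmod (tf_shift z \<phi> t)))"
          unfolding K_norm by (simp add: mult.assoc)
        ultimately have "(LINT t|lborel. norm (K z t)) \<le> \<bar>\<sigma> z\<bar> * (M * M)"
          by (simp add: mult_left_mono)
        then show "norm (LINT t|lborel. norm (K z t)) \<le> norm (\<sigma> z * (M * M))"
          by (simp add: abs_mult)
      qed
    qed
    then show "integrable lborel (\<lambda>z. LINT t|lborel. norm (case (z, t) of (z, t) \<Rightarrow> K z t))"
      by simp
  qed
  have inner: "(LINT t|lborel. K z t) = of_real (\<sigma> z * (cmod (stft \<phi> f z))\<^sup>2)" for z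
  proof -
    have "(LINT t|lborel. K z t)
        = of_real (\<sigma> z) * stft \<phi> f z * L2_inner (tf_shift z \<phi>) f"
      unfolding K_def L2_inner_def by (simp only: mult.assoc integral_mult_right_zero)
    also have "\<dots> = of_real (\<sigma> z) * (stft \<phi> f z * cnj (stft \<phi> f z))"
      using L2_inner_commute[of "tf_shift z \<phi>" f] by (simp add: stft_def)
    also have "stft \<phi> f z * cnj (stft \<phi> f z) = of_real ((cmod (stft \<phi> f z))\<^sup>2)"
      by (rule complex_norm_square[symmetric])
    finally show ?thesis by simp
  qed
  have "L2_inner (localization_op \<phi> \<sigma> f) f = (LINT t|lborel. LINT z|lborel. K z t)"
    unfolding L2_inner_def localization_op_def stft_adjoint_def K_def by simp
  also have "\<dots> = (LINT z|lborel. LINT t|lborel. K z t)"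
    by (rule lborel_pair.Fubini_integral[OF K_int])
  also have "\<dots> = of_real (LINT z|lborel. \<sigma> z * (cmod (stft \<phi> f z))\<^sup>2)"
    unfolding inner by (rule integral_complex_of_real)
  finally show ?thesis .
qed

lemma integrable_mult_stft_square:
  fixes \<phi> f :: "(real^'n) \<Rightarrow> complex"
  assumes \<rho>: "integrable lborel \<rho>" and \<phi>: "\<phi> \<in> L2" and f: "f \<in> L2"
  shows "integrable lborel (\<lambda>z. \<rho> z * (cmod (stft \<phi> f z))\<^sup>2)"
proof (rule Bochner_Integration.integrable_bound)
  have [measurable]: "\<rho> \<in> borel_measurable borel" "stft \<phi> f \<in> borel_measurable borel"
    using borel_measurable_integrable[OF \<rho>]
      borel_measurable_continuous_onI[OF continuous_on_stft[OF \<phi> f]] by auto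
  show "(\<lambda>z. \<rho> z * (cmod (stft \<phi> f z))\<^sup>2) \<in> borel_measurable lborel" by measurable
  show "integrable lborel (\<lambda>z. \<rho> z * (L2_norm f * L2_norm \<phi>)\<^sup>2)"
    using \<rho> by simp
  show "AE z in lborel. norm (\<rho> z * (cmod (stft \<phi> f z))\<^sup>2)
      \<le> norm (\<rho> z * (L2_norm f * L2_norm \<phi>)\<^sup>2)"
    using cmod_stft_le[OF \<phi> f] by (auto simp: abs_mult intro!: mult_left_mono power_mono)
qed

text \<open>
  If every \<open>V\<^sub>\<phi> e\<^sub>j\<close> vanished at \<open>z\<close>, the shifted window \<open>f = \<pi>(z)\<phi>\<close> would lie in the
  kernel of the operator, so \<open>\<sigma>\<close> would vanish almost everywhere on the open set
  \<open>{w. V\<^sub>\<phi> f(w) \<noteq> 0}\<close>. That set contains \<open>z\<close>.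
\<close>

lemma ess_support_imp_stft_eigenfunction_nonzero:
  fixes \<phi> :: "(real^'n) \<Rightarrow> complex"
  assumes \<sigma>: "integrable lborel \<sigma>" and nonneg: "AE w in lborel. 0 \<le> \<sigma> w"
    and \<phi>: "\<phi> \<in> L2" and \<phi>_nz: "L2_norm \<phi> \<noteq> 0"
    and spec: "spectral_representation (localization_op \<phi> \<sigma>) c e"
    and z: "z \<in> ess_support \<sigma>"
  shows "\<exists>j. stft \<phi> (e j) z \<noteq> 0"
proof (rule ccontr)
  assume "\<not> (\<exists>j. stft \<phi> (e j) z \<noteq> 0)"
  then have zero: "L2_inner (e j) (tf_shift z \<phi>) = 0" for j
    by (simp add: stft_def)
  define f where "f = tf_shift z \<phi>"
  have f: "f \<in> L2" unfolding f_def by (rule tf_shift_L2(1)[OF \<phi>])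
  have e: "e j \<in> L2" for j
    using spec by (simp add: spectral_representation_def orthonormal_system_def)
  have coeff: "L2_inner f (e j) = 0" for j
    using L2_inner_commute[of f] zero by (simp add: f_def)
  have sums: "L2_sums (\<lambda>j t. of_real (c j) * L2_inner f (e j) * e j t) (localization_op \<phi> \<sigma> f)"
    using spec f by (simp add: spectral_representation_def)
  \<comment> \<open>All partial sums are 0, so the norms in \<open>L2_sums\<close> form a constant sequence with limit 0.\<close>
  have Hf: "localization_op \<phi> \<sigma> f \<in> L2" and "L2_norm (localization_op \<phi> \<sigma> f) = 0"
    using sums LIMSEQ_unique[OF tendsto_const] by (auto simp: L2_sums_def coeff)
  then have "AE t in lborel. localization_op \<phi> \<sigma> f t = 0"
    by (intro L2_norm_eq_0_imp_AE)
  then have "AE t in lborel. localization_op \<phi> \<sigma> f t * cnj (f t) = 0"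
    by eventually_elim simp
  then have "L2_inner (localization_op \<phi> \<sigma> f) f = 0"
    unfolding L2_inner_def by (rule integral_eq_zero_AE)
  then have "(LINT w|lborel. \<sigma> w * (cmod (stft \<phi> f w))\<^sup>2) = 0"
    by (simp only: localization_op_quadratic_form[OF \<sigma> \<phi> f] of_real_eq_0_iff)
  moreover have "AE w in lborel. 0 \<le> \<sigma> w * (cmod (stft \<phi> f w))\<^sup>2"
    using nonneg by eventually_elim simp
  ultimately have "AE w in lborel. \<sigma> w * (cmod (stft \<phi> f w))\<^sup>2 = 0"
    using integral_nonneg_eq_0_iff_AE[OF integrable_mult_stft_square[OF \<sigma> \<phi> f]] by simp
  \<comment> \<open>\<open>\<sigma>\<close> can live only where \<open>V\<^sub>\<phi> f\<close> vanishes, which excludes a neighbourhood of \<open>z\<close>.\<close>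
  then have null: "AE w in lborel. w \<in> {w. stft \<phi> f w \<noteq> 0} \<longrightarrow> \<sigma> w = 0"
    by eventually_elim auto
  have "open {w. stft \<phi> f w \<noteq> 0}"
    by (intro open_Collect_neq continuous_on_stft \<phi> f continuous_on_const)
  moreover have "stft \<phi> f z \<noteq> 0"
    using \<phi>_nz by (simp add: stft_def L2_inner_self f_def[symmetric])
      (simp add: f_def tf_shift_L2(2)[OF \<phi>])
  ultimately show False
    using z null unfolding ess_support_def by blast
qed

text \<open>
  The quadratic form at the unit vector \<open>e j\<close> is its eigenvalue.
\<close>

lemma eigenvalue_eq_weighted_energy:
  fixes \<phi> :: "(real^'n) \<Rightarrow> complex"
  assumes \<sigma>: "integrable lborel \<sigma>" and \<phi>: "\<phi> \<in> L2"
    and spec: "spectral_representation (localization_op \<phi> \<sigma>) c e"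
  shows "c j = (LINT z|lborel. \<sigma> z * (cmod (stft \<phi> (e j) z))\<^sup>2)"
proof -
  have e: "e j \<in> L2" and norm1: "L2_inner (e j) (e j) = 1"
    and H: "localization_op \<phi> \<sigma> (e j) \<in> L2"
    and eig: "AE t in lborel. localization_op \<phi> \<sigma> (e j) t = of_real (c j) * e j t"
    using spec by (auto simp: spectral_representation_def orthonormal_system_def L2_sums_def)
  note [measurable] = L2_measurable[OF e] L2_measurable[OF H]
  have "L2_inner (localization_op \<phi> \<sigma> (e j)) (e j)
      = (LINT t|lborel. of_real (c j) * (e j t * cnj (e j t)))"
    unfolding L2_inner_def
  proof (rule integral_cong_AE)
    show "AE t in lborel. localization_op \<phi> \<sigma> (e j) t * cnj (e j t)
        = of_real (c j) * (e j t * cnj (e j t))"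
      using eig by eventually_elim (simp add: mult.assoc)
  qed measurable
  also have "\<dots> = of_real (c j)"
    using norm1 by (simp add: L2_inner_def)
  finally show ?thesis
    by (simp only: localization_op_quadratic_form[OF \<sigma> \<phi> e] of_real_eq_iff)
qed

section \<open>Concentration of the eigenfunctions\<close>

theorem proposition14:
  fixes \<phi> :: "(real^'n) \<Rightarrow> complex"
    and \<sigma> :: "(real^'n) \<times> (real^'n) \<Rightarrow> real"
    and \<Omega> :: "((real^'n) \<times> (real^'n)) set"
    and C :: real
    and c :: "nat \<Rightarrow> real"
    and e :: "nat \<Rightarrow> (real^'n) \<Rightarrow> complex"
  assumes "integrable lborel \<sigma>"
    and "AE z in lborel. 0 \<le> \<sigma> z"
    and "compact \<Omega>"
    and "AE z in lborel. z \<notin> \<Omega> \<longrightarrow> \<sigma> z = 0"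
    and "AE z in lborel. z \<in> \<Omega> \<longrightarrow> \<sigma> z \<le> C"
    and "\<phi> \<in> M1"
    and "L2_norm \<phi> = 1"
    and "spectral_representation (localization_op \<phi> \<sigma>) c e"
  shows "(\<forall>j. c j / C \<le> (LINT z:\<Omega>|lborel. (cmod (stft \<phi> (e j) z))\<^sup>2)) \<and>
    ((AE z in lborel. \<sigma> z / C = indicator \<Omega> z) \<longrightarrow>
       (\<forall>j. (LINT z:\<Omega>|lborel. (cmod (stft \<phi> (e j) z))\<^sup>2) = c j / C)) \<and>
    (\<Omega> - ess_support \<sigma> \<in> null_sets lborel \<longrightarrow>
       ((\<forall>j. (LINT z:\<Omega>|lborel. (cmod (stft \<phi> (e j) z))\<^sup>2) = c j / C) \<longleftrightarrow>
        (AE z in lborel. \<sigma> z / C = indicator \<Omega> z))) \<and>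
    (\<forall>j. (AE z in lborel. z \<in> \<Omega> \<longrightarrow> stft \<phi> (e j) z \<noteq> 0) \<longrightarrow>
       ((LINT z:\<Omega>|lborel. (cmod (stft \<phi> (e j) z))\<^sup>2) = c j / C \<longleftrightarrow>
        (AE z in lborel. \<sigma> z / C = indicator \<Omega> z)))"
proof -
  note \<sigma> = assms(1) and nonneg = assms(2) and outside = assms(4) and bound = assms(5)
    and spec = assms(8)
  have \<phi>: "\<phi> \<in> L2" using assms(6) by (simp add: M1_def)
  have e: "e j \<in> L2" and c_pos: "0 < c j" for j
    using spec by (auto simp: spectral_representation_def orthonormal_system_def)
  define E where "E j = (LINT z:\<Omega>|lborel. (cmod (stft \<phi> (e j) z))\<^sup>2)" for j
  define \<rho> where "\<rho> z = C * indicator \<Omega> z - \<sigma> z" for z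
  \<comment> \<open>For \<open>C \<le> 0\<close> the symbol would vanish almost everywhere and the eigenvalues would be 0.\<close>
  have C: "0 < C"
  proof (rule ccontr)
    assume "\<not> 0 < C"
    have "AE z in lborel. \<sigma> z * (cmod (stft \<phi> (e 0) z))\<^sup>2 = 0"
      using nonneg outside bound
    proof eventually_elim
      fix z assume "0 \<le> \<sigma> z" "z \<notin> \<Omega> \<longrightarrow> \<sigma> z = 0" "z \<in> \<Omega> \<longrightarrow> \<sigma> z \<le> C"
      then have "\<sigma> z = 0" using \<open>\<not> 0 < C\<close> by (cases "z \<in> \<Omega>") auto
      then show "\<sigma> z * (cmod (stft \<phi> (e 0) z))\<^sup>2 = 0" by simp
    qed
    then have "(LINT z|lborel. \<sigma> z * (cmod (stft \<phi> (e 0) z))\<^sup>2) = 0"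
      by (rule integral_eq_zero_AE)
    then show False
      using eigenvalue_eq_weighted_energy[OF \<sigma> \<phi> spec, of 0] c_pos[of 0] by simp
  qed
  have "emeasure lborel \<Omega> < \<infinity>"
    by (rule emeasure_bounded_finite[OF compact_imp_bounded[OF assms(3)]])
  then have ind: "integrable lborel (indicator \<Omega> :: _ \<Rightarrow> real)"
    using borel_compact[OF assms(3)] by (intro integrable_real_indicator) auto
  have \<rho>_int: "integrable lborel \<rho>"
    unfolding \<rho>_def using ind \<sigma> by simp
  have \<rho>_nonneg: "AE z in lborel. 0 \<le> \<rho> z"
    using outside bound by eventually_elim (auto simp: \<rho>_def indicator_def)
  \<comment> \<open>The defect in the inequality is the energy of \<open>V\<^sub>\<phi> e\<^sub>j\<close> weighted by \<open>\<rho>\<close>.\<close>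
  have gap: "C * E j - c j = (LINT z|lborel. \<rho> z * (cmod (stft \<phi> (e j) z))\<^sup>2)" for j
  proof -
    have "(LINT z|lborel. \<rho> z * (cmod (stft \<phi> (e j) z))\<^sup>2)
        = (LINT z|lborel. C * (indicator \<Omega> z * (cmod (stft \<phi> (e j) z))\<^sup>2)
            - \<sigma> z * (cmod (stft \<phi> (e j) z))\<^sup>2)"
      by (simp add: \<rho>_def left_diff_distrib mult.assoc)
    also have "\<dots> = C * (LINT z|lborel. indicator \<Omega> z * (cmod (stft \<phi> (e j) z))\<^sup>2)
        - (LINT z|lborel. \<sigma> z * (cmod (stft \<phi> (e j) z))\<^sup>2)"
      using integrable_mult_stft_square[OF ind \<phi> e] integrable_mult_stft_square[OF \<sigma> \<phi> e]
      by simp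
    finally show ?thesis
      by (simp add: E_def set_lebesgue_integral_def
          eigenvalue_eq_weighted_energy[OF \<sigma> \<phi> spec, symmetric])
  qed
  have integrand_nonneg: "AE z in lborel. 0 \<le> \<rho> z * (cmod (stft \<phi> (e j) z))\<^sup>2" for j
    using \<rho>_nonneg by eventually_elim simp
  have ineq: "c j / C \<le> E j" for j
    using gap[of j] integral_nonneg_AE[OF integrand_nonneg[of j]] C
    by (simp add: field_simps)
  have "E j = c j / C \<longleftrightarrow> C * E j - c j = 0" for j
    using C by (auto simp: field_simps)
  then have eq_iff: "E j = c j / C \<longleftrightarrow> (AE z in lborel. \<rho> z = 0 \<or> stft \<phi> (e j) z = 0)" for j
    using integral_nonneg_eq_0_iff_AE[OF integrable_mult_stft_square[OF \<rho>_int \<phi> e] integrand_nonneg, of j]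
    by (simp add: gap)
  have "\<sigma> z / C = indicator \<Omega> z \<longleftrightarrow> \<rho> z = 0" for z
    using C by (auto simp: \<rho>_def field_simps)
  then have char_iff: "(AE z in lborel. \<sigma> z / C = indicator \<Omega> z) \<longleftrightarrow> (AE z in lborel. \<rho> z = 0)"
    by simp
  have \<rho>_outside: "AE z in lborel. z \<notin> \<Omega> \<longrightarrow> \<rho> z = 0"
    using outside by eventually_elim (simp add: \<rho>_def)
  have sufficient: "E j = c j / C" if "AE z in lborel. \<rho> z = 0" for j
    unfolding eq_iff using that by eventually_elim simp
  have necessary_all: "AE z in lborel. \<rho> z = 0"
    if supp: "\<Omega> - ess_support \<sigma> \<in> null_sets lborel" and eq: "\<And>j. E j = c j / C"
  proof -
    \<comment> \<open>The index set is countable, so one null set serves all \<open>j\<close>.\<close>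
    have "AE z in lborel. \<forall>j. \<rho> z = 0 \<or> stft \<phi> (e j) z = 0"
      unfolding AE_all_countable eq_iff[symmetric] using eq by blast
    with AE_not_in[OF supp] \<rho>_outside show ?thesis
    proof eventually_elim
      fix z
      assume *: "z \<notin> \<Omega> - ess_support \<sigma>" "z \<notin> \<Omega> \<longrightarrow> \<rho> z = 0"
        "\<forall>j. \<rho> z = 0 \<or> stft \<phi> (e j) z = 0"
      show "\<rho> z = 0"
        using * ess_support_imp_stft_eigenfunction_nonzero[OF \<sigma> nonneg \<phi> _ spec, of z] assms(7)
        by auto
    qed
  qed
  have necessary_single: "AE z in lborel. \<rho> z = 0"
    if nz: "AE z in lborel. z \<in> \<Omega> \<longrightarrow> stft \<phi> (e j) z \<noteq> 0" and eq: "E j = c j / C" for j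
    using nz \<rho>_outside eq[unfolded eq_iff] by eventually_elim auto
  show ?thesis
    unfolding char_iff E_def[symmetric]
    using ineq sufficient necessary_all necessary_single by blast
qed

end
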